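(* A one-dimensional Schubert problem in $G(k,n)$ need not be a connected curve: there exist integers $0<k<n$, partitions $\lambda_1,\dots,\lambda_r\subseteq\Lambda$ with $\sum_i|\lambda_i|=k(n-k)-1$, and distinct points $p_1,\dots,p_r\in\mathbb{P}^1$ such that the curve $S(\lambda_\bullet,p_\bullet)\subset G(k,n)$ is nonempty and not connected.
   Context: Work over $\mathbb{C}$. For integers $0<k<n$, $\Lambda=((n-k)^k)$ is the $k\times(n-k)$ rectangular partition; $\lambda\subseteq\Lambda$ means $\lambda=(\lambda^{(1)}\ge\dots\ge\lambda^{(k)}\ge 0)$ with $\lambda^{(1)}\le n-k$, and $|\lambda|=\sum_j\lambda^{(j)}$. $G(k,n)$ is the Grassmannian of $k$-dimensional subspaces $V\subset H^0(\mathbb{P}^1,\mathcal{O}(n-1))$. For $p\in\mathbb{P}^1$, $\mathscr{F}(p)^j$ is the codimension-$j$ space of sections vanishing to order $\ge j$ at $p$ (the osculating flag), and $\Omega(\lambda,p)=\{V:\dim(V\cap\mathscr{F}(p)^{k-j+\lambda^{(j)}})\ge j,\ 1\le j\le k\}$. $S(\lambda_\bullet,p_\bullet)=\bigcap_i\Omega(\lambda_i,p_i)$ (scheme-theoretic intersection); it has pure dimension $k(n-k)-\sum|\lambda_i|$ when nonempty. Schubert problems in this setting are always taken with respect to these osculating flags. *)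

theory Defs
  imports
    "HOL-Analysis.Abstract_Topology"
    "HOL-Library.Poly_Mapping"
    "HOL-Computational_Algebra.Polynomial"
    "Jordan_Normal_Form.Determinant"
begin

section \<open>Sections of $\mathcal{O}(n-1)$ on the projective line and osculating flags\<close>

datatype proj_line = Fin complex | Infty

interpretation poly_vs: vector_space "smult :: complex \<Rightarrow> complex poly \<Rightarrow> complex poly"
  by unfold_locales (simp_all add: smult_add_left smult_add_right)

text \<open>
  A section of $\mathcal{O}(n-1)$, i.e. a binary form of degree $n-1$, is written in the affine
  coordinate as a polynomial of degree at most $n-1$ (used for $n \ge 1$ only).  The order of
  vanishing of a nonzero section $f$ at infinity is then $n-1-\deg f$.
\<close>

definition global_sections :: "nat \<Rightarrow> complex poly set" where
  "global_sections n = {f. degree f < n}"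

fun vanishing_order :: "nat \<Rightarrow> proj_line \<Rightarrow> complex poly \<Rightarrow> nat" where
  "vanishing_order n (Fin a) f = order a f"
| "vanishing_order n Infty f = n - 1 - degree f"

definition osculating_flag :: "nat \<Rightarrow> proj_line \<Rightarrow> nat \<Rightarrow> complex poly set" where
  "osculating_flag n p j = {f \<in> global_sections n. f = 0 \<or> j \<le> vanishing_order n p f}"


section \<open>The Grassmannian and its Zariski topology\<close>

definition Grassmannian :: "nat \<Rightarrow> nat \<Rightarrow> complex poly set set" where
  "Grassmannian k n =
     {V. poly_vs.subspace V \<and> V \<subseteq> global_sections n \<and> poly_vs.dim V = k}"

definition is_basis_of :: "complex poly list \<Rightarrow> complex poly set \<Rightarrow> bool" where
  "is_basis_of B V \<longleftrightarrow>
     distinct B \<and> poly_vs.independent (set B) \<and> poly_vs.span (set B) = V"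

text \<open>
  The Pluecker coordinate indexed by a \<open>k\<close>-subset \<open>I\<close> of \<open>{0..<n}\<close> is the maximal minor, with
  columns \<open>I\<close>, of the coefficient matrix of a basis; another basis rescales all coordinates
  by a common nonzero factor.
\<close>

definition plucker :: "complex poly list \<Rightarrow> nat set \<Rightarrow> complex" where
  "plucker B I =
     det (mat (length B) (length B) (\<lambda>(a, b). coeff (B ! a) (sorted_list_of_set I ! b)))"

text \<open>
  Polynomials in variables indexed by \<open>'v\<close>: finitely supported maps from monomials (exponent
  vectors) to coefficients.
\<close>

type_synonym 'v mpoly = "('v \<Rightarrow>\<^sub>0 nat) \<Rightarrow>\<^sub>0 complex"

definition eval_mpoly :: "('v \<Rightarrow> complex) \<Rightarrow> 'v mpoly \<Rightarrow> complex" where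
  "eval_mpoly x F =
     (\<Sum>m\<in>Poly_Mapping.keys F. Poly_Mapping.lookup F m *
        (\<Prod>i\<in>Poly_Mapping.keys m. x i ^ Poly_Mapping.lookup m i))"

definition homogeneous_in :: "'v set \<Rightarrow> nat \<Rightarrow> 'v mpoly \<Rightarrow> bool" where
  "homogeneous_in X d F \<longleftrightarrow>
     (\<forall>m\<in>Poly_Mapping.keys F. Poly_Mapping.keys m \<subseteq> X \<and>
        (\<Sum>i\<in>Poly_Mapping.keys m. Poly_Mapping.lookup m i) = d)"

definition plucker_indices :: "nat \<Rightarrow> nat \<Rightarrow> nat set set" where
  "plucker_indices k n = {I. I \<subseteq> {0..<n} \<and> card I = k}"

text \<open>
  The locus where a form in the Pluecker coordinates does not vanish.  By homogeneity it does
  not matter which basis of \<open>V\<close> is used.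
\<close>

definition nonvanishing_locus :: "nat \<Rightarrow> nat \<Rightarrow> nat set mpoly \<Rightarrow> complex poly set set" where
  "nonvanishing_locus k n F =
     {V \<in> Grassmannian k n. \<exists>B. is_basis_of B V \<and> eval_mpoly (plucker B) F \<noteq> 0}"

text \<open>The Zariski topology on closed points, induced by the Pluecker embedding.\<close>

definition zariski :: "nat \<Rightarrow> nat \<Rightarrow> complex poly set topology" where
  "zariski k n =
     topology_generated_by
       {nonvanishing_locus k n F | F d. homogeneous_in (plucker_indices k n) d F}"

lemma ex_basis:
  assumes "V \<in> Grassmannian k n"
  shows "\<exists>B. is_basis_of B V"
proof -
  have sub: "poly_vs.subspace V" and fin: "V \<subseteq> global_sections n"
    using assms by (auto simp: Grassmannian_def)
  obtain S where S: "S \<subseteq> V" "poly_vs.independent S" "V \<subseteq> poly_vs.span S"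
    using poly_vs.maximal_independent_subset by blast
  have "global_sections n \<subseteq> poly_vs.span ((\<lambda>i. monom 1 i) ` {..<n})"
  proof
    fix f assume "f \<in> global_sections n"
    then have d: "degree f < n" by (simp add: global_sections_def)
    have "f = (\<Sum>i\<le>degree f. smult (coeff f i) (monom 1 i))"
      by (simp add: smult_monom poly_as_sum_of_monoms)
    also have "\<dots> \<in> poly_vs.span ((\<lambda>i. monom 1 i) ` {..<n})"
      using d by (intro poly_vs.span_sum poly_vs.span_scale poly_vs.span_base) auto
    finally show "f \<in> poly_vs.span ((\<lambda>i. monom 1 i) ` {..<n})" .
  qed
  with S(1) fin have "S \<subseteq> poly_vs.span ((\<lambda>i. monom 1 i) ` {..<n})" by blast
  then have "finite S"
    using poly_vs.independent_span_bound S(2) by blast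
  then obtain B where "set B = S" "distinct B"
    using finite_distinct_list by blast
  moreover have "poly_vs.span S = V"
    using S sub poly_vs.span_minimal by blast
  ultimately show ?thesis using S(2) by (auto simp: is_basis_of_def)
qed

lemma topspace_zariski: "topspace (zariski k n) = Grassmannian k n"
proof -
  have "nonvanishing_locus k n 1 = Grassmannian k n"
    using ex_basis by (auto simp: nonvanishing_locus_def eval_mpoly_def)
  moreover have "homogeneous_in (plucker_indices k n) 0 1"
    by (simp add: homogeneous_in_def)
  ultimately show ?thesis
    unfolding zariski_def topology_generated_by_topspace
    by (auto simp: nonvanishing_locus_def)
qed


section \<open>Schubert varieties\<close>

text \<open>
  Partitions are weakly decreasing lists of length \<open>k\<close>, padded with zeros; the part
  $\lambda^{(j)}$, $1 \le j \le k$, is \<open>lam ! (j - 1)\<close>.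
\<close>

definition partition_in_rectangle :: "nat \<Rightarrow> nat \<Rightarrow> nat list \<Rightarrow> bool" where
  "partition_in_rectangle k n lam \<longleftrightarrow>
     length lam = k \<and> sorted_wrt (\<ge>) lam \<and> (\<forall>x\<in>set lam. x \<le> n - k)"

definition Schubert :: "nat \<Rightarrow> nat \<Rightarrow> nat list \<Rightarrow> proj_line \<Rightarrow> complex poly set set" where
  "Schubert k n lam p =
     {V \<in> Grassmannian k n.
        \<forall>j\<in>{1..k}. j \<le> poly_vs.dim (V \<inter> osculating_flag n p (k - j + lam ! (j - 1)))}"

text \<open>
  The closed points of the intersection; connectedness of a scheme only depends on its
  underlying space.
\<close>

definition Schubert_intersection ::
  "nat \<Rightarrow> nat \<Rightarrow> nat list list \<Rightarrow> proj_line list \<Rightarrow> complex poly set set" where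
  "Schubert_intersection k n lams ps =
     {V \<in> Grassmannian k n. \<forall>i<length lams. V \<in> Schubert k n (lams ! i) (ps ! i)}"

end

theory Submission
  imports Defs
begin

text \<open>
  In $G(4,8)$ take $\lambda = (3,1,1,0)$ at each of the points $0, \infty, 1$.  The conditions at
  $0$ and $\infty$ split $V$ as $\langle l \rangle \oplus W \oplus \langle u \rangle$ with
  $l \in \langle 1, x \rangle$, $W \subset \langle x^2, \dots, x^5 \rangle$,
  $u \in \langle x^6, x^7 \rangle$, and $V$ contains a section $h = (x-1)^6 (f + e x)$ whose
  components along $l$ and $u$ determine both.  Since $V$ has a three-dimensional intersection with
  $(x-1)^2$, the restrictions of $l$ and $u$ to the double point at $1$ are proportional, which
  reads $e^2 - 5 e f + f^2 = 0$.  Normalised as $l = 1 + z x$, this is $z^2 + 7 z + 7 = 0$: the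
  slope $z$ takes only two values on the curve, and both occur.  It is a ratio of Pluecker
  coordinates, so each value is taken on an open subset of the curve.
\<close>

section \<open>Linear algebra in spaces of polynomials\<close>

definition linear_form :: "(complex poly \<Rightarrow> complex) \<Rightarrow> bool" where
  "linear_form \<psi> \<longleftrightarrow> (\<forall>f g. \<psi> (f + g) = \<psi> f + \<psi> g) \<and> (\<forall>c f. \<psi> (smult c f) = c * \<psi> f)"

lemma linear_form_coeff: "linear_form (\<lambda>f. coeff f j)"
  by (simp add: linear_form_def)

lemma linear_form_add:
  "linear_form \<phi> \<Longrightarrow> linear_form \<psi> \<Longrightarrow> linear_form (\<lambda>f. \<phi> f + \<psi> f)"
  by (simp add: linear_form_def algebra_simps)

lemma subspace_kernel:
  assumes "linear_form \<psi>" "poly_vs.subspace U"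
  shows "poly_vs.subspace {f \<in> U. \<psi> f = 0}"
proof -
  have "\<psi> (smult 0 0) = 0 * \<psi> 0"
    using assms(1) unfolding linear_form_def by blast
  then show ?thesis
    using assms by (auto simp: linear_form_def poly_vs.subspace_def)
qed

text \<open>The kernel of \<open>\<psi>\<close> contains the span of \<open>S\<close> and misses
  \<open>g\<close>. The explicit bases below are checked by this triangular test.\<close>

lemma independent_insert_form:
  assumes "linear_form \<psi>" "\<psi> g \<noteq> 0" "\<forall>h\<in>S. \<psi> h = 0" "poly_vs.independent S"
  shows "g \<notin> S \<and> poly_vs.independent (insert g S)"
proof -
  have "poly_vs.subspace {f \<in> UNIV. \<psi> f = 0}"
    by (rule subspace_kernel[OF assms(1) poly_vs.subspace_UNIV])
  then have "poly_vs.span S \<subseteq> {f. \<psi> f = 0}"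
    using assms(3) by (intro poly_vs.span_minimal) auto
  then have "g \<notin> poly_vs.span S" using assms(2) by blast
  then show ?thesis
    using assms(4) poly_vs.independent_insertI poly_vs.span_base by blast
qed

text \<open>Lets the basis and cardinality lemmas for points of the Grassmannian be applied to
  subspaces of such a point.\<close>

lemma in_Grassmannian_dim:
  "poly_vs.subspace U \<Longrightarrow> U \<subseteq> global_sections n \<Longrightarrow> U \<in> Grassmannian (poly_vs.dim U) n"
  by (simp add: Grassmannian_def)

lemma Grassmannian_basis:
  assumes "V \<in> Grassmannian k n"
  obtains S where "finite S" "card S = k" "poly_vs.independent S" "poly_vs.span S = V"
proof -
  obtain B where B: "is_basis_of B V" using ex_basis[OF assms] by blast
  then have "poly_vs.dim V = card (set B)"
    using poly_vs.dim_span_eq_card_independent by (auto simp: is_basis_of_def)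
  with B assms show ?thesis
    by (intro that[of "set B"]) (auto simp: is_basis_of_def Grassmannian_def)
qed

lemma independent_card_le:
  assumes "V \<in> Grassmannian k n" "S \<subseteq> V" "poly_vs.independent S"
  shows "finite S \<and> card S \<le> k"
proof -
  obtain T where "finite T" "card T = k" "poly_vs.span T = V"
    by (rule Grassmannian_basis[OF assms(1)])
  then show ?thesis
    using poly_vs.independent_span_bound[of T S] assms by auto
qed

lemma span_eq_Grassmannian:
  assumes "V \<in> Grassmannian k n" "S \<subseteq> V" "poly_vs.independent S" "card S \<ge> k"
  shows "poly_vs.span S = V"
proof
  show "poly_vs.span S \<subseteq> V"
    using assms by (intro poly_vs.span_minimal) (auto simp: Grassmannian_def)
  show "V \<subseteq> poly_vs.span S"
  proof (rule ccontr)
    assume "\<not> V \<subseteq> poly_vs.span S"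
    then obtain v where v: "v \<in> V" "v \<notin> poly_vs.span S" by blast
    then have "poly_vs.independent (insert v S)" "v \<notin> S"
      using assms(3) poly_vs.independent_insertI poly_vs.span_base by blast+
    moreover have "finite S" using independent_card_le assms by blast
    ultimately have "card (insert v S) > k" using assms(4) by simp
    moreover have "card (insert v S) \<le> k"
      using independent_card_le[OF assms(1)] assms(2) v \<open>poly_vs.independent (insert v S)\<close>
      by blast
    ultimately show False by simp
  qed
qed

lemma dim_ge_card:
  assumes "poly_vs.subspace U" "U \<subseteq> global_sections n" "S \<subseteq> U" "poly_vs.independent S"
  shows "card S \<le> poly_vs.dim U"
  using independent_card_le[OF in_Grassmannian_dim] assms by blast

lemma dim_pos_nonzero:
  assumes "poly_vs.subspace U" "U \<subseteq> global_sections n" "poly_vs.dim U > 0"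
  shows "\<exists>f\<in>U. f \<noteq> 0"
proof -
  obtain S where S: "card S = poly_vs.dim U" "poly_vs.independent S" "poly_vs.span S = U"
    by (rule Grassmannian_basis[OF in_Grassmannian_dim[OF assms(1,2)]])
  then obtain f where "f \<in> S" using assms(3) by (cases "S = {}") auto
  then have "f \<noteq> 0" "f \<in> U"
    using S poly_vs.dependent_zero poly_vs.span_base by blast+
  then show ?thesis by blast
qed

text \<open>A basis of \<open>U\<close> together with \<open>g\<close> is independent with at least
  \<open>k\<close> elements, so it spans \<open>V\<close>; \<open>s\<close> is the coefficient of
  \<open>g\<close>.\<close>

lemma codim_one_decompose:
  assumes "V \<in> Grassmannian k n" "poly_vs.subspace U" "U \<subseteq> V" "k \<le> Suc (poly_vs.dim U)"
    and "g \<in> V" "g \<notin> U" "h \<in> V"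
  shows "\<exists>s. h - smult s g \<in> U"
proof -
  have "U \<subseteq> global_sections n" using assms(1,3) by (auto simp: Grassmannian_def)
  then obtain S where S: "finite S" "card S = poly_vs.dim U" "poly_vs.independent S"
    "poly_vs.span S = U"
    by (rule Grassmannian_basis[OF in_Grassmannian_dim[OF assms(2)]])
  then have "g \<notin> S" "poly_vs.independent (insert g S)"
    using assms(6) poly_vs.independent_insertI[of g S] poly_vs.span_base[of g S] by blast+
  moreover have "insert g S \<subseteq> V"
    using S(4) assms(3,5) poly_vs.span_superset by auto
  ultimately have "poly_vs.span (insert g S) = V"
    using span_eq_Grassmannian[OF assms(1)] S assms(4) by simp
  with assms(7) have "h \<in> poly_vs.span (insert g S)" by simp
  then show ?thesis
    using S(4) by (simp add: poly_vs.span_breakdown_eq)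
qed

lemma dim_less_of_mem:
  assumes "V \<in> Grassmannian k n" "poly_vs.subspace U" "U \<subseteq> V" "g \<in> V" "g \<notin> U"
  shows "poly_vs.dim U < k"
proof -
  have "U \<subseteq> global_sections n" using assms(1,3) by (auto simp: Grassmannian_def)
  then obtain S where S: "finite S" "card S = poly_vs.dim U" "poly_vs.independent S"
    "poly_vs.span S = U"
    by (rule Grassmannian_basis[OF in_Grassmannian_dim[OF assms(2)]])
  then have "g \<notin> S" "poly_vs.independent (insert g S)"
    using assms(5) poly_vs.independent_insertI[of g S] poly_vs.span_base[of g S] by blast+
  moreover have "insert g S \<subseteq> V"
    using S(4) assms(3,4) poly_vs.span_superset by auto
  ultimately show ?thesis
    using independent_card_le[OF assms(1), of "insert g S"] S(1,2) by simp
qed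

lemma independent_triple:
  assumes "linear_form \<psi>" "linear_form \<psi>'" "linear_form \<psi>''"
    and "\<psi> f \<noteq> 0" "\<psi> g = 0" "\<psi> h = 0" "\<psi>' g \<noteq> 0" "\<psi>' h = 0" "\<psi>'' h \<noteq> 0"
  shows "card {f, g, h} = 3 \<and> poly_vs.independent {f, g, h}"
proof -
  have "poly_vs.independent {h}"
    using independent_insert_form[OF assms(3,9), of "{}"] by (simp add: poly_vs.independent_empty)
  then have "g \<notin> {h} \<and> poly_vs.independent {g, h}"
    using assms(8) by (intro independent_insert_form[OF assms(2,7)]) auto
  moreover from this have "f \<notin> {g, h} \<and> poly_vs.independent {f, g, h}"
    using assms(5,6) by (intro independent_insert_form[OF assms(1,4)]) auto
  ultimately show ?thesis by simp
qed

section \<open>Kernels of coefficient forms and echelon bases\<close>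

lemma dim_kernel:
  assumes "poly_vs.subspace U" "U \<subseteq> global_sections n" "linear_form \<psi>" "f \<in> U" "\<psi> f \<noteq> 0"
  shows "poly_vs.dim U = Suc (poly_vs.dim {g \<in> U. \<psi> g = 0})"
proof -
  let ?K = "{g \<in> U. \<psi> g = 0}"
  have K: "poly_vs.subspace ?K" "?K \<subseteq> global_sections n"
    using subspace_kernel assms by auto
  obtain S where S: "finite S" "card S = poly_vs.dim ?K" "poly_vs.independent S"
    "poly_vs.span S = ?K"
    by (rule Grassmannian_basis[OF in_Grassmannian_dim[OF K]])
  have sub: "S \<subseteq> ?K" using S(4) poly_vs.span_superset by auto
  then have ins: "f \<notin> S" "poly_vs.independent (insert f S)"
    using independent_insert_form[OF assms(3,5) _ S(3)] by auto
  have "U \<subseteq> poly_vs.span (insert f S)"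
  proof
    fix g assume g: "g \<in> U"
    have "\<psi> (g + smult (- (\<psi> g / \<psi> f)) f) = \<psi> g + (- (\<psi> g / \<psi> f)) * \<psi> f"
      using assms(3) by (simp only: linear_form_def)
    then have "\<psi> (g - smult (\<psi> g / \<psi> f) f) = 0" using assms(5) by simp
    moreover have "g - smult (\<psi> g / \<psi> f) f \<in> U"
      using assms(1,4) g by (intro poly_vs.subspace_diff poly_vs.subspace_scale)
    ultimately show "g \<in> poly_vs.span (insert f S)"
      unfolding poly_vs.span_breakdown_eq S(4) by blast
  qed
  moreover have "poly_vs.span (insert f S) \<subseteq> U"
    using sub assms(1,4) by (intro poly_vs.span_minimal) auto
  ultimately have "poly_vs.span (insert f S) = U" by blast
  then show ?thesis
    using poly_vs.dim_span_eq_card_independent[OF ins(2)] ins(1) S(1,2) by simp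
qed

text \<open>Gaussian elimination from the lowest coefficient upwards. In the pivot columns
  \<open>js\<close> the coefficient matrix of \<open>gs\<close> is triangular with nonzero diagonal,
  which later gives a nonzero minor.\<close>

lemma echelon_family:
  assumes "poly_vs.subspace U" "U \<subseteq> global_sections n" "poly_vs.dim U = d"
  shows "\<exists>gs js. length gs = d \<and> length js = d \<and> set gs \<subseteq> U \<and> sorted_wrt (<) js \<and>
           distinct gs \<and> poly_vs.independent (set gs) \<and>
           (\<forall>i<d. coeff (gs ! i) (js ! i) \<noteq> 0 \<and> (\<forall>m<js ! i. coeff (gs ! i) m = 0))"
  using assms
proof (induction d arbitrary: U)
  case 0
  then show ?case by (intro exI[of _ "[]"]) (auto simp: poly_vs.independent_empty)
next
  case (Suc d)
  define P where "P m \<longleftrightarrow> (\<exists>f\<in>U. coeff f m \<noteq> 0)" for m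
  obtain f0 where "f0 \<in> U" "f0 \<noteq> 0"
    using dim_pos_nonzero[of U n] Suc.prems by auto
  then have ex: "P (degree f0)"
    unfolding P_def by (intro bexI[of _ f0]) simp_all
  \<comment> \<open>The lowest exponent occurring in any member of \<open>U\<close>. Splitting off
    one such member leaves the kernel of the \<open>j\<close>-th coefficient, one dimension
    smaller.\<close>
  define j where "j = (LEAST m. P m)"
  have "P j" unfolding j_def using ex by (rule LeastI)
  then obtain f where f: "f \<in> U" "coeff f j \<noteq> 0" unfolding P_def by blast
  have small: "coeff g m = 0" if "g \<in> U" "m < j" for g m
    using not_less_Least[of m P] that unfolding j_def P_def by blast
  let ?K = "{g \<in> U. coeff g j = 0}"
  have K1: "poly_vs.subspace ?K"
    using subspace_kernel[OF linear_form_coeff] Suc.prems(1) by blast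
  have K2: "?K \<subseteq> global_sections n" using Suc.prems(2) by blast
  have K3: "poly_vs.dim ?K = d"
    using dim_kernel[OF Suc.prems(1,2) linear_form_coeff f] Suc.prems(3) by simp
  obtain gs js where IH: "length gs = d" "length js = d" "set gs \<subseteq> ?K"
    "sorted_wrt (<) js" "distinct gs" "poly_vs.independent (set gs)"
    "\<And>i. i < d \<Longrightarrow> coeff (gs ! i) (js ! i) \<noteq> 0 \<and> (\<forall>m<js ! i. coeff (gs ! i) m = 0)"
    using Suc.IH[OF K1 K2 K3] by blast
  \<comment> \<open>On the kernel all coefficients up to and including \<open>j\<close> vanish, so
    its pivots come strictly later.\<close>
  have gt: "j < i" if i: "i \<in> set js" for i
  proof -
    obtain a where a: "a < d" "i = js ! a" using i IH(2) by (auto simp: in_set_conv_nth)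
    then have "gs ! a \<in> ?K" using IH(1,3) nth_mem by blast
    moreover have "coeff (gs ! a) i \<noteq> 0" using IH(7) a by blast
    ultimately show "j < i" using small by (cases i j rule: linorder_cases) auto
  qed
  have "f \<notin> set gs \<and> poly_vs.independent (insert f (set gs))"
    using IH(3,6) f(2) by (intro independent_insert_form[OF linear_form_coeff[of j]]) auto
  then show ?case
  proof (intro exI[of _ "f # gs"] exI[of _ "j # js"] conjI allI impI)
    fix i assume "i < Suc d"
    then show "coeff ((f # gs) ! i) ((j # js) ! i) \<noteq> 0"
      using f IH(7)[of "i - 1"] by (cases i) simp_all
    fix m assume "m < (j # js) ! i"
    then show "coeff ((f # gs) ! i) m = 0"
      using small[OF f(1)] IH(7)[of "i - 1"] \<open>i < Suc d\<close> by (cases i) simp_all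
  qed (use f IH(1-5) gt in auto)
qed

section \<open>Osculating flags\<close>

lemma osculating_flag_Fin:
  "osculating_flag n (Fin a) j = {f \<in> global_sections n. [:- a, 1:] ^ j dvd f}"
  by (auto simp: osculating_flag_def order_divides)

text \<open>The bound \<open>j < n\<close> keeps the zero section on the right-hand side, since
  \<open>global_sections 0\<close> is empty.\<close>

lemma osculating_flag_Infty:
  "j < n \<Longrightarrow> osculating_flag n Infty j = global_sections (n - j)"
  by (auto simp: osculating_flag_def global_sections_def)

lemma subspace_global_sections: "0 < n \<Longrightarrow> poly_vs.subspace (global_sections n)"
  by (auto simp: poly_vs.subspace_def global_sections_def degree_add_less
      intro: le_less_trans[OF degree_smult_le])

lemma subspace_osculating_flag:
  assumes "j < n"
  shows "poly_vs.subspace (osculating_flag n p j)"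
proof (cases p)
  case (Fin a)
  then show ?thesis
    using subspace_global_sections[of n] assms
    unfolding Fin osculating_flag_Fin poly_vs.subspace_def
    by (simp add: dvd_smult dvd_add)
next
  case Infty
  then show ?thesis
    using assms by (simp add: osculating_flag_Infty subspace_global_sections)
qed

lemma osculating_flag_antimono:
  "i \<le> j \<Longrightarrow> osculating_flag n p j \<subseteq> osculating_flag n p i"
  by (auto simp: osculating_flag_def)

lemma osculating_flag_Fin_0:
  "osculating_flag n (Fin 0) j = {f \<in> global_sections n. \<forall>m<j. coeff f m = 0}"
proof -
  have "[:- 0, 1:] ^ j dvd f \<longleftrightarrow> (\<forall>m<j. coeff f m = 0)" for f :: "complex poly"
    using monom_1_dvd_iff'[of j f] by (simp add: monom_altdef)
  then show ?thesis unfolding osculating_flag_Fin by blast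
qed

lemma linear_not_osculating:
  assumes "f \<in> global_sections 2" "f \<noteq> 0"
  shows "f \<notin> osculating_flag n (Fin a) 2"
proof
  assume "f \<in> osculating_flag n (Fin a) 2"
  then have "degree ([:- a, 1:] ^ 2) \<le> degree f"
    using assms(2) by (intro dvd_imp_degree_le) (auto simp: osculating_flag_Fin)
  then show False
    using assms(1) by (simp add: degree_linear_power global_sections_def)
qed

section \<open>Separating Pluecker forms\<close>

text \<open>With \<open>J = set js\<close> this is the linear form
  \<open>p_{1,J} - z p_{0,J}\<close>, which tests whether the ratio of two Pluecker coordinates is
  \<open>z\<close>.\<close>

definition slope_form :: "complex \<Rightarrow> nat list \<Rightarrow> nat set mpoly" where
  "slope_form z js =
     Poly_Mapping.single (Poly_Mapping.single (insert 1 (set js)) 1) 1 +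
     Poly_Mapping.single (Poly_Mapping.single (insert 0 (set js)) 1) (- z)"

lemma keys_binomial:
  "Poly_Mapping.keys (Poly_Mapping.single m a + Poly_Mapping.single m' b) \<subseteq> {m, m'}"
  using keys_add[of "Poly_Mapping.single m a" "Poly_Mapping.single m' b"]
  by (auto split: if_splits)

lemma eval_mpoly_linear_binomial:
  assumes "i \<noteq> i'"
  shows "eval_mpoly x (Poly_Mapping.single (Poly_Mapping.single i 1) a +
           Poly_Mapping.single (Poly_Mapping.single i' 1) b) = a * x i + b * x i'"
proof -
  let ?m = "Poly_Mapping.single i 1 :: 'a \<Rightarrow>\<^sub>0 nat"
  let ?m' = "Poly_Mapping.single i' 1 :: 'a \<Rightarrow>\<^sub>0 nat"
  let ?F = "Poly_Mapping.single ?m a + Poly_Mapping.single ?m' b"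
  have "Poly_Mapping.lookup ?m i \<noteq> Poly_Mapping.lookup ?m' i"
    using assms by (simp add: lookup_single)
  then have ne: "?m \<noteq> ?m'" by metis
  have "eval_mpoly x ?F = (\<Sum>m\<in>{?m, ?m'}. Poly_Mapping.lookup ?F m *
        (\<Prod>i\<in>Poly_Mapping.keys m. x i ^ Poly_Mapping.lookup m i))"
    unfolding eval_mpoly_def using keys_binomial[of ?m a ?m' b]
    by (intro sum.mono_neutral_left) (simp_all add: in_keys_iff)
  also have "\<dots> = a * x i + b * x i'"
    using ne by (simp add: lookup_add lookup_single when_def)
  finally show ?thesis .
qed

lemma homogeneous_slope_form:
  assumes "distinct js" "set js \<subseteq> {2..<n}" "length js = d" "2 \<le> n"
  shows "homogeneous_in (plucker_indices (Suc d) n) 1 (slope_form z js)"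
proof -
  have "0 \<notin> set js" "1 \<notin> set js" "set js \<subseteq> {0..<n}" using assms(2) by auto
  then have "insert 0 (set js) \<in> plucker_indices (Suc d) n"
    "insert 1 (set js) \<in> plucker_indices (Suc d) n"
    using assms by (simp_all add: plucker_indices_def distinct_card)
  then show ?thesis
    using keys_binomial unfolding homogeneous_in_def slope_form_def by fastforce
qed

text \<open>
  The entry \<open>0\<close> heading the column list is a dummy: the cofactors along the first column do
  not see it.
\<close>

definition slope_cofactor :: "complex poly list \<Rightarrow> nat list \<Rightarrow> nat \<Rightarrow> complex" where
  "slope_cofactor B js a =
     cofactor (mat (length B) (length B) (\<lambda>(a, b). coeff (B ! a) ((0 # js) ! b))) a 0"

text \<open>Laplace expansion along the first column. As \<open>i\<close> precedes all of
  \<open>js\<close>, it heads the sorted index list, and the cofactors do not depend on it.\<close>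

lemma plucker_insert:
  assumes "length B = Suc (length js)" "sorted_wrt (<) js" "\<forall>j\<in>set js. i < j"
  shows "plucker B (insert i (set js)) =
           (\<Sum>a<length B. coeff (B ! a) i * slope_cofactor B js a)"
proof -
  have "sorted_list_of_set (set (i # js)) = i # js"
    using assms by (intro sorted_list_of_set.idem_if_sorted_distinct)
      (auto simp: strict_sorted_iff)
  then have sl: "sorted_list_of_set (insert i (set js)) = i # js" by simp
  let ?A = "mat (length B) (length B) (\<lambda>(a, b). coeff (B ! a) ((i # js) ! b))"
  have "plucker B (insert i (set js)) = (\<Sum>a<length B. ?A $$ (a, 0) * cofactor ?A a 0)"
    unfolding plucker_def sl
    by (rule laplace_expansion_column) (use assms(1) in auto)
  also have "\<dots> = (\<Sum>a<length B. coeff (B ! a) i * slope_cofactor B js a)"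
  proof (rule sum.cong)
    fix a assume a: "a \<in> {..<length B}"
    have "mat_delete ?A a 0 =
        mat_delete (mat (length B) (length B) (\<lambda>(a, b). coeff (B ! a) ((0 # js) ! b))) a 0"
      by (rule eq_matI) (auto simp: mat_delete_def)
    then show "?A $$ (a, 0) * cofactor ?A a 0 = coeff (B ! a) i * slope_cofactor B js a"
      using a assms(1) by (simp add: cofactor_def slope_cofactor_def)
  qed simp
  finally show ?thesis .
qed

text \<open>The coordinates for 1 and for 0 share their cofactors, so the first column enters only
  through the deviation of each row from slope \<open>z\<close>.\<close>

lemma eval_slope_form:
  assumes "length B = Suc (length js)" "sorted_wrt (<) js" "\<forall>j\<in>set js. 2 \<le> j"
  shows "eval_mpoly (plucker B) (slope_form z js) =
           (\<Sum>a<length B. (coeff (B ! a) 1 - z * coeff (B ! a) 0) * slope_cofactor B js a)"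
proof -
  have ne: "insert 1 (set js) \<noteq> insert 0 (set js)" using assms(3) by force
  have gt: "\<forall>j\<in>set js. 1 < j" "\<forall>j\<in>set js. 0 < j" using assms(3) by force+
  show ?thesis
    unfolding slope_form_def eval_mpoly_linear_binomial[OF ne]
      plucker_insert[OF assms(1,2) gt(1)] plucker_insert[OF assms(1,2) gt(2)]
    by (simp add: sum_distrib_left left_diff_distrib sum_subtractf sum_negf mult.assoc)
qed

section \<open>Slope forms at points of the Grassmannian\<close>

lemma basis_length:
  assumes "V \<in> Grassmannian k n" "is_basis_of B V"
  shows "length B = k"
proof -
  have "card (set B) = poly_vs.dim V"
    using assms(2) poly_vs.dim_span_eq_card_independent by (auto simp: is_basis_of_def)
  then show ?thesis
    using assms by (auto simp: Grassmannian_def is_basis_of_def distinct_card)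
qed

lemma slope_form_vanishes:
  assumes "\<forall>f\<in>V. coeff f 1 = z * coeff f 0"
    and "sorted_wrt (<) js" "\<forall>j\<in>set js. 2 \<le> j"
  shows "V \<notin> nonvanishing_locus (Suc (length js)) n (slope_form z js)"
proof -
  have "eval_mpoly (plucker B) (slope_form z js) = 0"
    if B: "V \<in> Grassmannian (Suc (length js)) n" "is_basis_of B V" for B
  proof -
    have len: "length B = Suc (length js)" using basis_length that by blast
    have "set B \<subseteq> V"
      using that(2) poly_vs.span_superset by (auto simp: is_basis_of_def)
    then have "coeff (B ! a) 1 = z * coeff (B ! a) 0" if "a < length B" for a
      using assms(1) that nth_mem by blast
    then show ?thesis
      by (simp add: eval_slope_form[OF len assms(2,3)])
  qed
  then show ?thesis by (auto simp: nonvanishing_locus_def)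
qed

text \<open>In the basis made of \<open>l\<close> and an echelon basis of \<open>U\<close>, only
  \<open>l\<close> contributes to the expansion, and its cofactor is the triangular minor at the
  pivots. The pivots depend on \<open>V\<close>, hence the existential \<open>js\<close>.\<close>

lemma slope_form_nonvanishing:
  assumes V: "V \<in> Grassmannian (Suc d) n"
    and l: "l \<in> V" "coeff l 1 \<noteq> z * coeff l 0"
    and U: "poly_vs.subspace U" "U \<subseteq> V" "poly_vs.dim U = d"
    and U0: "\<forall>f\<in>U. coeff f 0 = 0 \<and> coeff f 1 = 0"
  shows "\<exists>js. length js = d \<and> sorted_wrt (<) js \<and> set js \<subseteq> {2..<n} \<and>
           V \<in> nonvanishing_locus (Suc d) n (slope_form z js)"
proof -
  have Un: "U \<subseteq> global_sections n" using U V by (auto simp: Grassmannian_def)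
  obtain gs js where E: "length gs = d" "length js = d" "set gs \<subseteq> U" "sorted_wrt (<) js"
    "distinct gs" "poly_vs.independent (set gs)"
    "\<And>i. i < d \<Longrightarrow> coeff (gs ! i) (js ! i) \<noteq> 0 \<and> (\<forall>m<js ! i. coeff (gs ! i) m = 0)"
    using echelon_family[OF U(1) Un U(3)] by blast
  \<comment> \<open>A pivot is an exponent of some section in \<open>U\<close>, so it is below
    \<open>n\<close>; the exponents 0 and 1 do not occur in \<open>U\<close>.\<close>
  have js: "set js \<subseteq> {2..<n}"
  proof
    fix j assume "j \<in> set js"
    then obtain i where i: "i < d" "j = js ! i" using E(2) by (auto simp: in_set_conv_nth)
    then have "gs ! i \<in> U" "coeff (gs ! i) j \<noteq> 0" using E(1,3,7) nth_mem by blast+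
    moreover from this have "j \<le> degree (gs ! i)" by (intro le_degree)
    moreover have "degree (gs ! i) < n"
      using \<open>gs ! i \<in> U\<close> Un by (auto simp: global_sections_def)
    moreover have "j \<noteq> 0" "j \<noteq> 1"
      using \<open>gs ! i \<in> U\<close> \<open>coeff (gs ! i) j \<noteq> 0\<close> U0 by metis+
    ultimately show "j \<in> {2..<n}" by simp
  qed
  then have js2: "\<forall>j\<in>set js. 2 \<le> j" by auto
  have "linear_form (\<lambda>f. coeff f 1 - z * coeff f 0)"
    by (simp add: linear_form_def algebra_simps)
  then have "l \<notin> set gs \<and> poly_vs.independent (insert l (set gs))"
    by (rule independent_insert_form) (use l(2) U0 E(3,6) in auto)
  then have ins: "l \<notin> set gs" "poly_vs.independent (insert l (set gs))" by auto
  let ?B = "l # gs"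
  have len: "length ?B = Suc (length js)" using E by simp
  have "poly_vs.span (set ?B) = V"
    using ins E l U(2) by (intro span_eq_Grassmannian[OF V]) (auto simp: distinct_card)
  then have basis: "is_basis_of ?B V"
    using ins E(5) by (simp add: is_basis_of_def)
  have "slope_cofactor ?B js 0 \<noteq> 0"
  proof -
    let ?T = "mat d d (\<lambda>(a, b). coeff (gs ! a) (js ! b))"
    have "mat_delete (mat (length ?B) (length ?B) (\<lambda>(a, b). coeff (?B ! a) ((0 # js) ! b))) 0 0
        = ?T"
      using E(1) by (intro eq_matI) (auto simp: mat_delete_def)
    then have "slope_cofactor ?B js 0 = det ?T"
      by (simp add: slope_cofactor_def cofactor_def)
    \<comment> \<open>An entry left of the diagonal is a coefficient of \<open>gs ! a\<close> below
      its pivot.\<close>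
    also have "\<dots> = prod_list (diag_mat ?T)"
      using E(2,4,7)
      by (intro det_upper_triangular[OF _ mat_carrier])
        (auto simp: upper_triangular_def sorted_wrt_iff_nth_less)
    finally show ?thesis
      using E(7) by (auto simp: prod_list_zero_iff diag_mat_def)
  qed
  moreover have "coeff (gs ! a) 1 - z * coeff (gs ! a) 0 = 0" if "a < d" for a
  proof -
    have "gs ! a \<in> U" using that E(1,3) nth_mem by blast
    then show ?thesis using U0 by simp
  qed
  then have "eval_mpoly (plucker ?B) (slope_form z js) =
      (coeff l 1 - z * coeff l 0) * slope_cofactor ?B js 0"
    unfolding eval_slope_form[OF len E(4) js2]
    using E(1) by (simp add: sum.lessThan_Suc_shift del: sum.lessThan_Suc)
  ultimately have "eval_mpoly (plucker ?B) (slope_form z js) \<noteq> 0"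
    using l(2) by simp
  then show ?thesis
    using V basis E(2,4) js by (auto simp: nonvanishing_locus_def)
qed


section \<open>The curve\<close>

text \<open>The size is 5, so three copies impose 15 conditions on the 16-dimensional
  \<open>G(4,8)\<close>.\<close>

definition hook :: "nat list" where
  "hook = [3, 1, 1, 0]"

text \<open>The required orders for \<open>j = 1, 2, 3, 4\<close> are 6, 3, 2, 0; the one for order
  0 amounts to \<open>V\<close> having dimension 4.\<close>

lemma Schubert_hook_iff:
  "V \<in> Schubert 4 8 hook p \<longleftrightarrow> V \<in> Grassmannian 4 8 \<and>
     1 \<le> poly_vs.dim (V \<inter> osculating_flag 8 p 6) \<and>
     2 \<le> poly_vs.dim (V \<inter> osculating_flag 8 p 3) \<and>
     3 \<le> poly_vs.dim (V \<inter> osculating_flag 8 p 2)"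
proof -
  have "{1..4::nat} = {1, 2, 3, 4}" by auto
  moreover have "V \<inter> osculating_flag 8 p 0 = V \<and> poly_vs.dim V = 4" if "V \<in> Grassmannian 4 8"
    using that by (auto simp: Grassmannian_def osculating_flag_def)
  ultimately show ?thesis
    unfolding Schubert_def hook_def by (auto simp: eval_nat_numeral)
qed

text \<open>The flag is nested, so \<open>{h}\<close>, \<open>{g, h}\<close> and
  \<open>{f, g, h}\<close> witness dimensions 1, 2 and 3.\<close>

lemma Schubert_hook_I:
  assumes V: "V \<in> Grassmannian 4 8" "{f, g, h} \<subseteq> V"
    and ind: "card {f, g, h} = 3 \<and> poly_vs.independent {f, g, h}"
    and osc: "f \<in> osculating_flag 8 p 2" "g \<in> osculating_flag 8 p 3" "h \<in> osculating_flag 8 p 6"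
  shows "V \<in> Schubert 4 8 hook p"
proof -
  have bound: "card S \<le> poly_vs.dim (V \<inter> osculating_flag 8 p j)"
    if "S \<subseteq> V \<inter> osculating_flag 8 p j" "S \<subseteq> {f, g, h}" "j < 8" for S j
    using that V ind poly_vs.independent_mono
    by (intro dim_ge_card poly_vs.subspace_inter subspace_osculating_flag)
      (auto simp: Grassmannian_def)
  have "card {g, h} = 2" using ind by (auto simp: card_insert_if split: if_splits)
  moreover have "{h} \<subseteq> V \<inter> osculating_flag 8 p 6" "{g, h} \<subseteq> V \<inter> osculating_flag 8 p 3"
    "{f, g, h} \<subseteq> V \<inter> osculating_flag 8 p 2"
    using V(2) osc osculating_flag_antimono[of 3 6 8 p] osculating_flag_antimono[of 2 3 8 p]
    by auto
  ultimately show ?thesis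
    using bound[of "{h}" 6] bound[of "{g, h}" 3] bound[of "{f, g, h}" 2] ind V(1)
    by (simp add: Schubert_hook_iff)
qed

section \<open>The curve for the points \<open>Fin 0\<close>, \<open>Infty\<close> and
  \<open>Fin 1\<close>, and the slopes of its points\<close>

definition two_component_curve :: "complex poly set set" where
  "two_component_curve =
     Schubert_intersection 4 8 (replicate 3 hook) [Fin 0, Infty, Fin 1]"

lemma two_component_curve_iff:
  "V \<in> two_component_curve \<longleftrightarrow> (\<forall>p\<in>{Fin 0, Infty, Fin 1}. V \<in> Schubert 4 8 hook p)"
proof -
  have all3: "(\<forall>i<3. P i) \<longleftrightarrow> P 0 \<and> P 1 \<and> P 2" for P :: "nat \<Rightarrow> bool"
    by (auto simp: eval_nat_numeral less_Suc_eq)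
  have "V \<in> Grassmannian 4 8" if "V \<in> Schubert 4 8 hook p" for p
    using that by (simp add: Schubert_def)
  then show ?thesis
    unfolding two_component_curve_def Schubert_intersection_def length_replicate all3
    by auto
qed

text \<open>The general section of degree at most 7 with order at least 6 at the point 1. Its two
  lowest and two highest coefficients get compared with \<open>l\<close> and
  \<open>u\<close>.\<close>

lemma linear_sixth_power:
  "[:- 1, 1:] ^ 6 * [:f, e:] = [:f, e - 6 * f, 15 * f - 6 * e, 15 * e - 20 * f,
     15 * f - 20 * e, 15 * e - 6 * f, f - 6 * e, e:]" for e f :: complex
  by (simp add: eval_nat_numeral algebra_simps)

text \<open>The first and last clauses make \<open>z\<close> unique; the hyperplane in the middle is
  the input to \<open>slope_form_nonvanishing\<close>.\<close>

definition slope_decomposition :: "complex \<Rightarrow> complex poly set \<Rightarrow> bool" where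
  "slope_decomposition z V \<longleftrightarrow> [:1, z:] \<in> V \<and>
     (\<exists>U. poly_vs.subspace U \<and> U \<subseteq> V \<and> poly_vs.dim U = 3 \<and>
        (\<forall>f\<in>U. coeff f 0 = 0 \<and> coeff f 1 = 0)) \<and>
     (\<forall>f\<in>V. coeff f 1 = z * coeff f 0)"

text \<open>Order 6 at each point supplies \<open>l\<close>, \<open>u\<close>, \<open>h\<close>. The
  hyperplane of order 2 at each point relates two of them: \<open>h\<close> to \<open>l\<close> at
  0, \<open>h\<close> to \<open>u\<close> at infinity, \<open>u\<close> to \<open>l\<close> at 1.
  Eliminating the three multipliers leaves the quadratic.\<close>

lemma two_component_curve_slope:
  assumes "V \<in> two_component_curve"
  shows "\<exists>z. z\<^sup>2 + 7 * z + 7 = 0 \<and> slope_decomposition z V"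
proof -
  have S: "V \<in> Schubert 4 8 hook (Fin 0)" "V \<in> Schubert 4 8 hook Infty"
    "V \<in> Schubert 4 8 hook (Fin 1)"
    using assms by (auto simp: two_component_curve_iff)
  then have V: "V \<in> Grassmannian 4 8" and sub: "poly_vs.subspace V" "V \<subseteq> global_sections 8"
    by (auto simp: Schubert_hook_iff Grassmannian_def)
  have subs: "poly_vs.subspace (V \<inter> osculating_flag 8 p j)" if "j < 8" for p j
    using that sub by (intro poly_vs.subspace_inter subspace_osculating_flag)
  have nz: "\<exists>f\<in>V \<inter> osculating_flag 8 p 6. f \<noteq> 0" if "V \<in> Schubert 4 8 hook p" for p
    using that sub(2) by (intro dim_pos_nonzero[of _ 8] subs) (auto simp: Schubert_hook_iff)
  have split: "\<exists>s. h - smult s g \<in> V \<inter> osculating_flag 8 p 2"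
    if "V \<in> Schubert 4 8 hook p" "g \<in> V" "g \<notin> osculating_flag 8 p 2" "h \<in> V" for p g h
    using that by (intro codim_one_decompose[OF V subs]) (auto simp: Schubert_hook_iff)
  have osc: "osculating_flag 8 Infty 6 = global_sections 2"
    "osculating_flag 8 Infty 2 = global_sections 6"
    by (simp_all add: osculating_flag_Infty)

  obtain l where l: "l \<in> V" "l \<in> global_sections 2" "l \<noteq> 0"
    using nz[OF S(2)] unfolding osc by blast
  obtain u where u: "u \<in> V" "u \<in> osculating_flag 8 (Fin 0) 6" "u \<noteq> 0"
    using nz[OF S(1)] by blast
  obtain h where h: "h \<in> V" "h \<in> osculating_flag 8 (Fin 1) 6" "h \<noteq> 0"
    using nz[OF S(3)] by blast
  define \<alpha> \<beta> where "\<alpha> = coeff l 0" and "\<beta> = coeff l 1"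
  have l_eq: "l = [:\<alpha>, \<beta>:]"
    using l(2) by (intro poly_eqI)
      (auto simp: \<alpha>_def \<beta>_def coeff_pCons coeff_eq_0 global_sections_def split: nat.splits)
  define \<gamma> \<delta> where "\<gamma> = coeff u 6" and "\<delta> = coeff u 7"
  have u_deg: "degree u < 8" and u_low: "\<forall>m<6. coeff u m = 0"
    using u(2) by (auto simp: osculating_flag_Fin_0 global_sections_def)
  have u_eq: "u = [:0, 0, 0, 0, 0, 0, \<gamma>, \<delta>:]"
  proof (rule poly_eqI)
    fix m :: nat
    consider "m < 6" | "m = 6" | "m = 7" | "m \<ge> 8" by linarith
    then show "coeff u m = coeff [:0, 0, 0, 0, 0, 0, \<gamma>, \<delta>:] m"
    proof cases
      case 1
      then have "m \<in> {0, 1, 2, 3, 4, 5}" by auto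
      then show ?thesis using u_low 1 by (auto simp: eval_nat_numeral)
    next
      case 4
      then have "coeff u m = 0" using u_deg by (intro coeff_eq_0) simp
      moreover have "coeff [:0, 0, 0, 0, 0, 0, \<gamma>, \<delta>:] m = 0"
        using 4 by (intro coeff_eq_0) (auto intro: le_less_trans[OF degree_pCons_le])
      ultimately show ?thesis by simp
    qed (simp_all add: \<gamma>_def \<delta>_def eval_nat_numeral)
  qed
  obtain q where q: "h = [:- 1, 1:] ^ 6 * q" and h_deg: "degree h < 8"
    using h(2) by (auto simp: osculating_flag_Fin global_sections_def elim: dvdE)
  then have "degree q < 2"
    using h(3) by (auto simp: degree_mult_eq degree_linear_power)
  define f e where "f = coeff q 0" and "e = coeff q 1"
  have "q = [:f, e:]"
    using \<open>degree q < 2\<close> by (intro poly_eqI)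
      (auto simp: f_def e_def coeff_pCons coeff_eq_0 split: nat.splits)
  then have h_eq: "h = [:f, e - 6 * f, 15 * f - 6 * e, 15 * e - 20 * f,
     15 * f - 20 * e, 15 * e - 6 * f, f - 6 * e, e:]"
    using q linear_sixth_power by simp
  have fe: "f \<noteq> 0 \<or> e \<noteq> 0" using h(3) h_eq by auto

  let ?U = "V \<inter> osculating_flag 8 (Fin 0) 2"
  have lU: "l \<notin> osculating_flag 8 (Fin a) 2" for a
    using linear_not_osculating l by blast
  have U0: "coeff g 0 = 0 \<and> coeff g 1 = 0" if "g \<in> ?U" for g
    using that by (auto simp: osculating_flag_Fin_0)
  \<comment> \<open>Order 2 at 0 kills the coefficients 0 and 1 of the difference, so those of
    \<open>h\<close> are \<open>s\<close> times those of \<open>l\<close>.\<close>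
  obtain s where "h - smult s l \<in> ?U" using split[OF S(1) l(1) lU h(1)] by blast
  then have s: "f = s * \<alpha>" "e - 6 * f = s * \<beta>"
    using U0[THEN conjunct1] U0[THEN conjunct2] by (fastforce simp: h_eq l_eq)+
  have "6 \<le> degree u"
    using u(2,3) dvd_imp_degree_le[of "[:- 0, 1:] ^ 6" u]
    by (simp add: osculating_flag_Fin degree_linear_power)
  then have "u \<notin> osculating_flag 8 Infty 2"
    by (simp add: osc global_sections_def)
  \<comment> \<open>Order 2 at infinity kills the coefficients 6 and 7 in the same way.\<close>
  then obtain t where "h - smult t u \<in> V \<inter> osculating_flag 8 Infty 2"
    using split[OF S(2) u(1) _ h(1)] by blast
  then have "degree (h - smult t u) < 6"
    by (simp add: osc global_sections_def)
  then have "coeff (h - smult t u) 6 = 0" "coeff (h - smult t u) 7 = 0"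
    by (simp_all only: coeff_eq_0)
  then have t: "f - 6 * e = t * \<gamma>" "e = t * \<delta>"
    by (simp_all add: h_eq u_eq eval_nat_numeral)
  obtain r where "u - smult r l \<in> V \<inter> osculating_flag 8 (Fin 1) 2"
    using split[OF S(3) l(1) lU u(1)] by blast
  then obtain w where w: "u - smult r l = [:- 1, 1:] ^ 2 * w"
    by (auto simp: osculating_flag_Fin elim: dvdE)
  \<comment> \<open>A double zero at 1 is expressed by value and derivative there.\<close>
  have "poly (u - smult r l) 1 = 0" "poly (pderiv (u - smult r l)) 1 = 0"
    by (simp_all only: w power2_eq_square pderiv_mult poly_mult poly_add) simp_all
  then have r: "\<gamma> + \<delta> = r * (\<alpha> + \<beta>)" "6 * \<gamma> + 7 * \<delta> = r * \<beta>"
    by (simp_all add: u_eq l_eq pderiv_pCons algebra_simps)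

  have "s \<noteq> 0" using s fe by auto
  \<comment> \<open>Value and derivative at 1 of \<open>smult t u\<close>, rewritten in
    \<open>f\<close> and \<open>e\<close>.\<close>
  have "f - 5 * e = t * \<gamma> + t * \<delta>" "6 * f - 29 * e = 6 * (t * \<gamma>) + 7 * (t * \<delta>)"
    unfolding t[symmetric] by simp_all
  then have "f - 5 * e = t * (\<gamma> + \<delta>)" "6 * f - 29 * e = t * (6 * \<gamma> + 7 * \<delta>)"
    by (simp_all only: distrib_left mult.left_commute)
  then have "s * (f - 5 * e) = r * t * (s * \<alpha> + s * \<beta>)"
    "s * (6 * f - 29 * e) = r * t * (s * \<beta>)"
    by (simp_all only: r) (simp_all add: algebra_simps)
  then have A: "s * (f - 5 * e) = r * t * (e - 5 * f)"
    and B: "s * (6 * f - 29 * e) = r * t * (e - 6 * f)"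
    unfolding s[symmetric] by simp_all
  \<comment> \<open>Cross-multiplying \<open>A\<close> and \<open>B\<close> eliminates
    \<open>r * t\<close> without dividing by it, as it might be zero; only \<open>s\<close> is
    cancelled.\<close>
  have "s * ((f - 5 * e) * (e - 6 * f)) = s * (f - 5 * e) * (e - 6 * f)" by simp
  also have "\<dots> = r * t * (e - 6 * f) * (e - 5 * f)" unfolding A by simp
  also have "\<dots> = s * ((6 * f - 29 * e) * (e - 5 * f))" unfolding B[symmetric] by simp
  finally have "(f - 5 * e) * (e - 6 * f) - (6 * f - 29 * e) * (e - 5 * f) = 0"
    using \<open>s \<noteq> 0\<close> by simp
  moreover have "(f - 5 * e) * (e - 6 * f) - (6 * f - 29 * e) * (e - 5 * f) =
      24 * (e\<^sup>2 - 5 * e * f + f\<^sup>2)"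
    by (simp add: algebra_simps power2_eq_square)
  ultimately have "24 * (e\<^sup>2 - 5 * e * f + f\<^sup>2) = 0" by (simp only:)
  then have quad: "e\<^sup>2 - 5 * e * f + f\<^sup>2 = 0" by (simp only: mult_eq_0_iff) simp
  \<comment> \<open>Substituting \<open>f = s * \<alpha>\<close> and
    \<open>e = s * \<beta> + 6 * (s * \<alpha>)\<close> turns the quadratic into a condition on
    \<open>l\<close> alone.\<close>
  have "s\<^sup>2 * (\<beta>\<^sup>2 + 7 * \<alpha> * \<beta> + 7 * \<alpha>\<^sup>2) =
      (s * \<beta>)\<^sup>2 + 7 * (s * \<alpha>) * (s * \<beta>) + 7 * (s * \<alpha>)\<^sup>2"
    by (simp add: algebra_simps power2_eq_square)
  also have "\<dots> = e\<^sup>2 - 5 * e * f + f\<^sup>2"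
    unfolding s[symmetric] by (simp add: algebra_simps power2_eq_square)
  finally have "s\<^sup>2 * (\<beta>\<^sup>2 + 7 * \<alpha> * \<beta> + 7 * \<alpha>\<^sup>2) = 0"
    using quad by simp
  with \<open>s \<noteq> 0\<close> have rel: "\<beta>\<^sup>2 + 7 * \<alpha> * \<beta> + 7 * \<alpha>\<^sup>2 = 0" by simp
  then have \<alpha>: "\<alpha> \<noteq> 0" using l(3) l_eq by auto
  define z where "z = \<beta> / \<alpha>"
  have \<beta>: "\<beta> = z * \<alpha>" using \<alpha> by (simp add: z_def)
  have "\<alpha>\<^sup>2 * (z\<^sup>2 + 7 * z + 7) = 0"
    using rel unfolding \<beta> by (simp add: algebra_simps power2_eq_square)
  then have z: "z\<^sup>2 + 7 * z + 7 = 0" using \<alpha> by simp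
  have "smult (1 / \<alpha>) l \<in> V" using sub(1) l(1) by (rule poly_vs.subspace_scale)
  then have 1: "[:1, z:] \<in> V" using \<alpha> by (simp add: l_eq z_def)
  \<comment> \<open>\<open>l\<close> lies in \<open>V\<close> but not in \<open>?U\<close>, so the
    Schubert bound 3 is attained exactly.\<close>
  have "poly_vs.dim ?U < 4"
    using lU by (intro dim_less_of_mem[OF V subs _ l(1)]) auto
  then have 2: "poly_vs.dim ?U = 3" using S(1) by (simp add: Schubert_hook_iff)
  have 3: "coeff g 1 = z * coeff g 0" if g: "g \<in> V" for g
  proof -
    obtain c where "g - smult c l \<in> ?U" using split[OF S(1) l(1) lU g] by blast
    from U0[OF this] show ?thesis by (simp add: l_eq \<beta>)
  qed
  have "slope_decomposition z V"
    unfolding slope_decomposition_def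
  proof (intro conjI exI[of _ ?U] ballI)
    show "poly_vs.subspace ?U" by (rule subs) simp
  qed (use 1 2 3 U0 in simp_all)
  with z show ?thesis by blast
qed

text \<open>Here \<open>v\<close> is \<open>x^2 (x - 1)^3\<close>, and \<open>l\<close>,
  \<open>w\<close>, \<open>u\<close> are the low, middle and high parts of the section
  \<open>h\<close> of order 6 at 1, the middle one reduced modulo \<open>v\<close> to start at
  \<open>x^3\<close>.\<close>

lemma two_component_curve_witness:
  fixes z :: complex
  assumes z: "z\<^sup>2 + 7 * z + 7 = 0"
  shows "\<exists>V\<in>two_component_curve. [:1, z:] \<in> V"
proof -
  \<comment> \<open>\<open>y\<close> is the ratio \<open>e / f\<close> for
    \<open>h = (x - 1)^6 (f + e x)\<close>: with \<open>f = 1\<close> the linear coefficient of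
    \<open>h\<close> is \<open>y - 6 = z\<close>.\<close>
  define y where "y = z + 6"
  have "y * y - (5 * y - 1) = z\<^sup>2 + 7 * z + 7"
    by (simp add: y_def power2_eq_square algebra_simps)
  with z have y2: "y * y = 5 * y - 1" by simp
  \<comment> \<open>The same reduction for products that \<open>algebra_simps\<close> nests to the
    right.\<close>
  have y2': "y * (y * c) = (5 * y - 1) * c" for c
    using y2 by (simp only: mult.assoc[symmetric])
  \<comment> \<open>The conjugate root is \<open>5 - y\<close>; these are norms up to a factor.\<close>
  have norm: "y * (5 - y) = 1" "(25 - 3 * y) * (10 + 3 * y) = 259" "(1 - 5 * y) * (5 * y - 24) = 1"
    "(- 2 - 30 * y) * (30 * y - 152) = 1204" "(9 + 9 * y) * (6 - y) = 63"
    by (simp_all add: algebra_simps y2 y2')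
  have ne: "y \<noteq> 0" "25 - 3 * y \<noteq> 0" "1 - 5 * y \<noteq> 0" "- 2 - 30 * y \<noteq> 0" "9 + 9 * y \<noteq> 0"
    using norm by (metis mult_zero_left zero_neq_numeral zero_neq_one)+
  define l where "l = [:1, y - 6:]"
  define v :: "complex poly" where "v = [:0, 0, - 1, 3, - 3, 1:]"
  define w where "w = [:0, 0, 0, 25 - 3 * y, - 30 - 2 * y, 9 + 9 * y:]"
  define u where "u = [:0, 0, 0, 0, 0, 0, 1 - 6 * y, y:]"
  define V where "V = poly_vs.span {l, v, w, u}"
  note defs = l_def v_def w_def u_def
  have span: "smult a l + smult b v + smult c w + smult d u \<in> V" for a b c d
    unfolding V_def
    by (intro poly_vs.span_add poly_vs.span_scale poly_vs.span_base) auto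
  have mem: "l \<in> V" "v \<in> V" "w \<in> V" "u \<in> V"
    unfolding V_def by (auto intro: poly_vs.span_base)

  have vwu: "card {v, w, u} = 3 \<and> poly_vs.independent {v, w, u}"
    by (rule independent_triple[OF linear_form_coeff[of 2] linear_form_coeff[of 3]
          linear_form_coeff[of 7]]) (use ne in \<open>simp_all add: defs eval_nat_numeral\<close>)
  have "l \<notin> {v, w, u} \<and> poly_vs.independent {l, v, w, u}"
    by (rule independent_insert_form[OF linear_form_coeff[of 0]])
      (use vwu in \<open>auto simp: defs\<close>)
  then have "poly_vs.dim V = 4"
    using vwu unfolding V_def by (subst poly_vs.dim_span_eq_card_independent) simp_all
  moreover have "V \<subseteq> global_sections 8"
    unfolding V_def
    by (rule poly_vs.span_minimal[OF _ subspace_global_sections])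
      (use ne in \<open>auto simp: defs global_sections_def\<close>)
  ultimately have V: "V \<in> Grassmannian 4 8"
    by (simp add: Grassmannian_def V_def)

  have S0: "V \<in> Schubert 4 8 hook (Fin 0)"
    by (rule Schubert_hook_I[OF V _ vwu])
      (use mem ne in \<open>auto simp: osculating_flag_Fin_0 global_sections_def defs
         eval_nat_numeral less_Suc_eq\<close>)

  \<comment> \<open>Subtracting a multiple of \<open>v\<close> from \<open>w\<close> removes the
    \<open>x^5\<close> term; degree 4 means order 3 at infinity.\<close>
  define w' where "w' = [:0, 0, 9 + 9 * y, - 2 - 30 * y, - 3 + 25 * y:]"
  have "w' = smult 0 l + smult (- 9 - 9 * y) v + smult 1 w + smult 0 u"
    by (simp add: w'_def defs algebra_simps)
  then have "w' \<in> V" using span by metis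
  moreover have "card {v, w', l} = 3 \<and> poly_vs.independent {v, w', l}"
    by (rule independent_triple[OF linear_form_coeff[of 5] linear_form_coeff[of 3]
          linear_form_coeff[of 0]]) (use ne in \<open>simp_all add: w'_def defs eval_nat_numeral\<close>)
  ultimately have S1: "V \<in> Schubert 4 8 hook Infty"
    by (intro Schubert_hook_I[OF V, of v w' l])
      (use mem in \<open>auto simp: osculating_flag_Infty global_sections_def w'_def defs\<close>)

  define h where "h = [:- 1, 1:] ^ 6 * [:1, y:]"
  have h_eq: "h = [:1, y - 6, 15 - 6 * y, 15 * y - 20, 15 - 20 * y, 15 * y - 6, 1 - 6 * y, y:]"
    unfolding h_def linear_sixth_power by simp
  then have "h = smult 1 l + smult (6 * y - 15) v + smult 1 w + smult 1 u"
    by (simp add: defs algebra_simps)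
  then have "h \<in> V" using span by metis
  \<comment> \<open>The combination of \<open>l\<close> and \<open>u\<close> with a double zero at
    1; it exists thanks to the quadratic. The factor \<open>5 - y\<close> is the inverse of
    \<open>y\<close> and makes \<open>g\<close> monic.\<close>
  define g where "g = [:1 - 5 * y, 6 * y - 1, 0, 0, 0, 0, - 1 - y, 1:]"
  have "g = smult (1 - 5 * y) l + smult 0 v + smult 0 w + smult (5 - y) u"
    by (simp add: g_def defs algebra_simps y2 y2')
  then have "g \<in> V" using span by metis
  have "g = [:- 1, 1:] ^ 2 * [:1 - 5 * y, 1 - 4 * y, 1 - 3 * y, 1 - 2 * y, 1 - y, 1:]"
    by (simp add: g_def power2_eq_square algebra_simps)
  then have g_dvd: "[:- 1, 1:] ^ 2 dvd g" by (rule dvdI)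
  have "v = [:- 1, 1:] ^ 3 * [:0, 0, 1:]"
    by (simp add: v_def power3_eq_cube)
  then have v_dvd: "[:- 1, 1:] ^ 3 dvd v" by (rule dvdI)
  have "card {h, g, v} = 3 \<and> poly_vs.independent {h, g, v}"
    \<comment> \<open>The sum of the coefficients 2 and 5 vanishes on \<open>v\<close> and
      \<open>g\<close> but equals \<open>9 + 9 * y\<close> on \<open>h\<close>.\<close>
    by (rule independent_triple[OF linear_form_add[OF linear_form_coeff[of 2] linear_form_coeff[of 5]]
          linear_form_coeff[of 0] linear_form_coeff[of 2]])
      (use ne in \<open>simp_all add: h_eq g_def v_def eval_nat_numeral algebra_simps\<close>)
  moreover have "{h, g, v} = {g, v, h}" by auto
  ultimately have "card {g, v, h} = 3 \<and> poly_vs.independent {g, v, h}" by simp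
  moreover have "[:- 1, 1:] ^ 6 dvd h" unfolding h_def by (rule dvd_triv_left)
  moreover have gvh: "{g, v, h} \<subseteq> V" using \<open>g \<in> V\<close> \<open>h \<in> V\<close> mem(2) by simp
  moreover have "{g, v, h} \<subseteq> global_sections 8"
    using gvh V by (auto simp: Grassmannian_def)
  ultimately have S2: "V \<in> Schubert 4 8 hook (Fin 1)"
    using g_dvd v_dvd by (intro Schubert_hook_I[OF V, of g v h]) (simp_all add: osculating_flag_Fin)
  have "[:1, z:] \<in> V" using mem(1) by (simp add: l_def y_def)
  with S0 S1 S2 show ?thesis by (auto simp: two_component_curve_iff)
qed

text \<open>On the curve, the open set \<open>E z\<close> consists of the points of slope other than
  \<open>z\<close>. As only two slopes occur, \<open>E x\<close> and \<open>E y\<close> separate the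
  curve.\<close>

lemma two_component_curve_disconnected:
  "\<not> connectedin (zariski 4 8) two_component_curve"
proof -
  define x y where "x = (- 7 + csqrt 21) / 2" and "y = (- 7 - csqrt 21) / 2"
  have "csqrt 21 * csqrt 21 = 21" using power2_csqrt[of 21] by (simp add: power2_eq_square)
  then have roots: "z\<^sup>2 + 7 * z + 7 = (z - x) * (z - y)" for z
    by (simp add: x_def y_def field_simps power2_eq_square)
  have "x \<noteq> y" by (auto simp: x_def y_def)
  \<comment> \<open>No single choice of columns need detect every \<open>V\<close>, so all candidate
    pivot lists are united.\<close>
  define E where "E z = (\<Union>js\<in>{js. length js = 3 \<and> sorted_wrt (<) js \<and> set js \<subseteq> {2..<8}}.
      nonvanishing_locus 4 8 (slope_form z js))" for z
  have openE: "openin (zariski 4 8) (E z)" for z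
  proof -
    have "openin (zariski 4 8) (nonvanishing_locus 4 8 (slope_form z js))"
      if "length js = 3" "sorted_wrt (<) js" "set js \<subseteq> {2..<8}" for js
    proof -
      have "homogeneous_in (plucker_indices 4 8) 1 (slope_form z js)"
        using homogeneous_slope_form[of js 8 3] that by (simp add: strict_sorted_iff)
      then show ?thesis
        unfolding zariski_def by (intro topology_generated_by_Basis) blast
    qed
    then show ?thesis unfolding E_def by blast
  qed
  have in_E: "V \<in> E z \<longleftrightarrow> z \<noteq> c"
    if V: "V \<in> two_component_curve" and c: "slope_decomposition c V" for V z c
  proof
    assume "z \<noteq> c"
    obtain U where U: "poly_vs.subspace U" "U \<subseteq> V" "poly_vs.dim U = 3"
        "\<forall>f\<in>U. coeff f 0 = 0 \<and> coeff f 1 = 0"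
      using c by (auto simp: slope_decomposition_def)
    have "V \<in> Grassmannian (Suc 3) 8" "[:1, c:] \<in> V"
      using V c by (auto simp: two_component_curve_iff Schubert_hook_iff slope_decomposition_def)
    from slope_form_nonvanishing[OF this _ U, of z] show "V \<in> E z"
      using \<open>z \<noteq> c\<close> by (auto simp: E_def)
  next
    assume "V \<in> E z"
    then show "z \<noteq> c"
      using slope_form_vanishes[of V c _ 8] c
      by (fastforce simp: E_def slope_decomposition_def)
  qed
  have slope: "\<exists>c\<in>{x, y}. slope_decomposition c V" if "V \<in> two_component_curve" for V
    using two_component_curve_slope[OF that] roots by auto
  \<comment> \<open>\<open>E z\<close> meets the curve in points of the other slope
    \<open>c\<close>, so the witness is taken at \<open>c\<close>.\<close>
  have meets: "E z \<inter> two_component_curve \<noteq> {}" if zc: "{z, c} = {x, y}" for z c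
  proof -
    have "c\<^sup>2 + 7 * c + 7 = 0" using roots zc by (auto simp: doubleton_eq_iff)
    then obtain V where V: "V \<in> two_component_curve" "[:1, c:] \<in> V"
      using two_component_curve_witness by blast
    obtain c' where c': "slope_decomposition c' V" using slope[OF V(1)] by blast
    then have "c = c'" using V(2) by (fastforce simp: slope_decomposition_def)
    then show ?thesis
      using in_E[OF V(1) c'] V(1) zc \<open>x \<noteq> y\<close> by (auto simp: doubleton_eq_iff)
  qed
  have "two_component_curve \<subseteq> E x \<union> E y" "E x \<inter> E y \<inter> two_component_curve = {}"
    using slope in_E \<open>x \<noteq> y\<close> by blast+
  moreover have "E x \<inter> two_component_curve \<noteq> {}" "E y \<inter> two_component_curve \<noteq> {}"
    using meets[of x y] meets[of y x] by auto
  ultimately show ?thesis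
    unfolding connectedin using openE by blast
qed

theorem mainTheorem3:
  shows "\<exists>(k::nat) (n::nat) (lams :: nat list list) (ps :: proj_line list).
           0 < k \<and> k < n \<and>
           length ps = length lams \<and>
           (\<forall>lam\<in>set lams. partition_in_rectangle k n lam) \<and>
           (\<Sum>lam\<leftarrow>lams. sum_list lam) = k * (n - k) - 1 \<and>
           distinct ps \<and>
           Schubert_intersection k n lams ps \<noteq> {} \<and>
           \<not> connectedin (zariski k n) (Schubert_intersection k n lams ps)"
proof (intro exI conjI)
  let ?lams = "[[3, 1, 1, 0], [3, 1, 1, 0], [3, 1, 1, 0]] :: nat list list"
  let ?ps = "[Fin 0, Infty, Fin 1]"
  show "\<not> connectedin (zariski 4 8) (Schubert_intersection 4 8 ?lams ?ps)"
    using two_component_curve_disconnected by (simp add: two_component_curve_def hook_def eval_nat_numeral)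
  \<comment> \<open>The empty set counts as connected, so the failure of connectedness already gives
    a point.\<close>
  then show "Schubert_intersection 4 8 ?lams ?ps \<noteq> {}"
    by (auto simp: connectedin_empty)
qed (auto simp: partition_in_rectangle_def)

end
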